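(* In the exploration setting described in the context, there is an algorithm for searching arbitrary (potentially directed) weighted graphs which finds the goal $g$ by traveling a total distance of at most $$\mathrm{OPT} + \mathcal{E}_1^- + n\cdot \mathcal{E}_\infty^+,$$ where $n=|V|$, $\mathcal{E}_1^- = \sum_{v\in V}\max\{0,\, d_G(v,g)-f(v)\}$ and $\mathcal{E}_\infty^+ = \max_{v\in V}\max\{0,\, f(v)-d_G(v,g)\}$.
   Context: Graph searching in the exploration setting: $G=(V,E)$ is a finite graph, possibly directed, with positive edge weights, and $d_G$ denotes the weighted shortest-path distance in $G$. An agent starts at a root vertex $r\in V$ and must reach an unknown goal vertex $g\in V$; it recognizes $g$ when it visits it. There is a prediction function $f:V\to\mathbb{R}$ (a noisy estimate of $d_G(v,g)$). For $S\subseteq V$, $\partial S$ denotes the set of vertices outside $S$ adjacent to some vertex of $S$. Initially the agent knows only $r$, its neighbours, the edges between them and the predictions at these vertices. At iteration $i$, having visited the set $V_{i-1}$ (with $V_0=\{r\}$), the agent knows only the subgraph $G_i$ consisting of the vertices $V_{i-1}\cup\partial V_{i-1}$ and all edges incident to $V_{i-1}$, together with the predictions at these vertices; it picks a vertex $v_i$ of $\partial V_{i-1}$ and travels to it, paying $d_{G_i}(v_{i-1},v_i)$ (distance in the known subgraph). The cost $\mathrm{ALG}$ is the total distance travelled until $g$ is visited, and $\mathrm{OPT}=d_G(r,g)$. *)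

theory Defs
  imports
    "HOL-Library.FuncSet"
    "Graph_Theory.Pair_Digraph"
    "Graph_Theory.Shortest_Path"
begin

text \<open>
  A graph is a digraph without parallel arcs; an undirected graph is the special case of a
  symmetric arc set with symmetric weights. Distances are extended reals, with value infinity
  when there is no directed walk.
\<close>

abbreviation gdist :: "'a pair_pre_digraph \<Rightarrow> ('a \<times> 'a \<Rightarrow> real) \<Rightarrow> 'a \<Rightarrow> 'a \<Rightarrow> ereal" where
  "gdist G w u v \<equiv> wf_digraph.\<mu> (with_proj G) w u v"

text \<open>For directed graphs, adjacency to \<open>S\<close> means being the head of an arc with tail in \<open>S\<close>.\<close>

definition boundary :: "'a pair_pre_digraph \<Rightarrow> 'a set \<Rightarrow> 'a set" where
  "boundary G S = {v \<in> pverts G - S. \<exists>u\<in>S. (u, v) \<in> parcs G}"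

text \<open>
  An arc from \<open>boundary G S\<close> back into \<open>S\<close> is known, an arc between two boundary vertices is not.
  An arc entering \<open>S\<close> from a vertex that is not (yet) known is not part of the known subgraph.
\<close>

definition known_subgraph :: "'a pair_pre_digraph \<Rightarrow> 'a set \<Rightarrow> 'a pair_pre_digraph" where
  "known_subgraph G S =
     \<lparr> pverts = S \<union> boundary G S,
       parcs = {(u, v) \<in> parcs G. (u \<in> S \<or> v \<in> S) \<and>
                  u \<in> S \<union> boundary G S \<and> v \<in> S \<union> boundary G S} \<rparr>"

text \<open>
  The information available to the agent. Weights and predictions are cut down to the known arcs
  and vertices by \<^const>\<open>restrict\<close>, so that a function of the view cannot depend on
  anything unexplored; in particular the goal and the number of vertices are not part of the view.
\<close>

record 'a view =
  visited :: "'a list"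
  known :: "'a pair_pre_digraph"
  known_weight :: "'a \<times> 'a \<Rightarrow> real"
  known_pred :: "'a \<Rightarrow> real"

definition view_of ::
    "'a pair_pre_digraph \<Rightarrow> ('a \<times> 'a \<Rightarrow> real) \<Rightarrow> ('a \<Rightarrow> real) \<Rightarrow> 'a list \<Rightarrow> 'a view" where
  "view_of G w f t =
     \<lparr> visited = t,
       known = known_subgraph G (set t),
       known_weight = restrict w (parcs (known_subgraph G (set t))),
       known_pred = restrict f (pverts (known_subgraph G (set t))) \<rparr>"

type_synonym 'a search_alg = "'a view \<Rightarrow> 'a"

definition weighted_graph :: "'a pair_pre_digraph \<Rightarrow> ('a \<times> 'a \<Rightarrow> real) \<Rightarrow> bool" where
  "weighted_graph G w \<longleftrightarrow> pair_fin_digraph G \<and> (\<forall>e\<in>parcs G. 0 < w e)"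

text \<open>The next vertex is always chosen in the boundary of the set of visited vertices.\<close>

definition is_search_alg :: "'a search_alg \<Rightarrow> bool" where
  "is_search_alg alg \<longleftrightarrow>
     (\<forall>G w f t. weighted_graph G w \<and> t \<noteq> [] \<and> set t \<subseteq> pverts G \<and> boundary G (set t) \<noteq> {}
        \<longrightarrow> alg (view_of G w f t) \<in> boundary G (set t))"

text \<open>
  \<open>trail alg G w f r i\<close> is the list of the first \<open>i + 1\<close> chosen vertices, beginning with the root.
  It is only meaningful up to the first visit of the goal, where the search stops.
\<close>

primrec trail ::
    "'a search_alg \<Rightarrow> 'a pair_pre_digraph \<Rightarrow> ('a \<times> 'a \<Rightarrow> real) \<Rightarrow> ('a \<Rightarrow> real) \<Rightarrow> 'a \<Rightarrow> nat \<Rightarrow> 'a list"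
  where
  "trail alg G w f r 0 = [r]"
| "trail alg G w f r (Suc i) =
     trail alg G w f r i @ [alg (view_of G w f (trail alg G w f r i))]"

definition agent_pos ::
    "'a search_alg \<Rightarrow> 'a pair_pre_digraph \<Rightarrow> ('a \<times> 'a \<Rightarrow> real) \<Rightarrow> ('a \<Rightarrow> real) \<Rightarrow> 'a \<Rightarrow> nat \<Rightarrow> 'a"
  where
  "agent_pos alg G w f r i = last (trail alg G w f r i)"

definition finds_goal ::
    "'a search_alg \<Rightarrow> 'a pair_pre_digraph \<Rightarrow> ('a \<times> 'a \<Rightarrow> real) \<Rightarrow> ('a \<Rightarrow> real) \<Rightarrow> 'a \<Rightarrow> 'a \<Rightarrow> bool"
  where
  "finds_goal alg G w f r g \<longleftrightarrow> (\<exists>k. agent_pos alg G w f r k = g)"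

text \<open>
  Total distance travelled up to the first visit of \<open>g\<close>, each hop being measured in the subgraph
  known before the hop. A hop that is impossible in that subgraph (which can occur in a directed
  graph) costs infinity. Meaningful only together with \<open>finds_goal\<close>.
\<close>

definition search_cost ::
    "'a search_alg \<Rightarrow> 'a pair_pre_digraph \<Rightarrow> ('a \<times> 'a \<Rightarrow> real) \<Rightarrow> ('a \<Rightarrow> real) \<Rightarrow> 'a \<Rightarrow> 'a \<Rightarrow> ereal"
  where
  "search_cost alg G w f r g =
     (\<Sum>i < (LEAST k. agent_pos alg G w f r k = g).
        gdist (known_subgraph G (set (trail alg G w f r i))) w
          (agent_pos alg G w f r i) (agent_pos alg G w f r (Suc i)))"

definition err_1_minus ::
    "'a pair_pre_digraph \<Rightarrow> ('a \<times> 'a \<Rightarrow> real) \<Rightarrow> ('a \<Rightarrow> real) \<Rightarrow> 'a \<Rightarrow> ereal" where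
  "err_1_minus G w f g = (\<Sum>v\<in>pverts G. max 0 (gdist G w v g - ereal (f v)))"

definition err_inf_plus ::
    "'a pair_pre_digraph \<Rightarrow> ('a \<times> 'a \<Rightarrow> real) \<Rightarrow> ('a \<Rightarrow> real) \<Rightarrow> 'a \<Rightarrow> ereal" where
  "err_inf_plus G w f g = Max ((\<lambda>v. max 0 (ereal (f v) - gdist G w v g)) ` pverts G)"

end

theory Submission
  imports Defs
begin

text \<open>
  The algorithm moves greedily to a boundary vertex \<open>v\<close> minimising the known distance to \<open>v\<close> plus the
  prediction at \<open>v\<close>. From position \<open>x\<close>, one candidate is the vertex \<open>u\<close> at which a shortest path
  from \<open>x\<close> to \<open>g\<close> leaves the visited set; the part of the path before \<open>u\<close> is known, so the minimum
  is at most \<open>d(x,g) - d(u,g) + f(u)\<close>, hence at most \<open>d(x,g)\<close> plus the maximal overestimate. So a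
  hop from \<open>x\<close> to \<open>v\<close> costs at most \<open>d(x,g) - d(v,g)\<close>, plus the underestimate at \<open>v\<close>, plus the maximal
  overestimate, and these bounds telescope. If some vertex cannot reach \<open>g\<close>, its underestimate is
  infinite and the bound is trivial.
\<close>

text \<open>The boundary is recovered from the view as the known vertices not yet visited;
  \<open>arg_min_on\<close> settles ties by choice.\<close>

definition greedy_alg :: "'a search_alg" where
  "greedy_alg V = arg_min_on
     (\<lambda>v. gdist (known V) (known_weight V) (last (visited V)) v + ereal (known_pred V v))
     (pverts (known V) - set (visited V))"

section \<open>Weighted digraphs and distances\<close>

lemma weighted_graph_imp_fin_digraph: "weighted_graph G w \<Longrightarrow> fin_digraph (with_proj G)"
  unfolding weighted_graph_def pair_fin_digraph_def pair_fin_digraph_axioms_def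
    fin_digraph_def fin_digraph_axioms_def wf_digraph_wp_iff by simp

lemma weighted_graph_imp_wf_digraph: "weighted_graph G w \<Longrightarrow> wf_digraph (with_proj G)"
  by (intro fin_digraph.axioms(1) weighted_graph_imp_fin_digraph)

lemma finite_boundary: "weighted_graph G w \<Longrightarrow> finite (boundary G S)"
  unfolding weighted_graph_def boundary_def by (auto dest: pair_fin_digraph.pair_finite_verts)

lemma wf_digraph_known_subgraph: "wf_digraph (with_proj (known_subgraph G S))"
  by unfold_locales (auto simp: known_subgraph_def)

text \<open>Walks use only arcs of the graph. This reconciles the agent's computation, made with
  weights restricted to the known arcs, with the cost measured by the original weights.\<close>

lemma gdist_cong:
  assumes "wf_digraph (with_proj G)" and "\<And>e. e \<in> parcs G \<Longrightarrow> w e = w' e"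
  shows "gdist G w u v = gdist G w' u v"
proof -
  interpret wf_digraph "with_proj G" by fact
  have "awalk_cost w p = awalk_cost w' p" if "awalk u p v" for p
    using that assms(2) unfolding awalk_def awalk_cost_def
    by (intro arg_cong[where f = sum_list] map_cong) auto
  then show ?thesis
    unfolding \<mu>_def by (intro INF_cong) auto
qed

lemma gdist_nonneg:
  assumes "weighted_graph G w"
  shows "0 \<le> gdist G w u v"
proof -
  interpret wf_digraph "with_proj G"
    using assms by (rule weighted_graph_imp_wf_digraph)
  have "0 \<le> awalk_cost w p" if "awalk u p v" for p
    using that by (rule pos_cost_pos_awalk_cost)
      (use assms in \<open>auto simp: weighted_graph_def less_imp_le\<close>)
  then show ?thesis
    unfolding \<mu>_def by (intro INF_greatest) auto
qed

lemma gdist_self: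
  assumes "weighted_graph G w" "v \<in> pverts G"
  shows "gdist G w v v = 0"
proof -
  interpret wf_digraph "with_proj G"
    using assms(1) by (rule weighted_graph_imp_wf_digraph)
  have "gdist G w v v \<le> ereal (awalk_cost w [])"
    using assms(2) by (intro min_cost_le_walk_cost) (simp add: awalk_Nil_iff)
  then show ?thesis
    using gdist_nonneg[OF assms(1), of v v] by (simp add: zero_ereal_def[symmetric])
qed

section \<open>The greedy choice and a single hop\<close>

lemma greedy_alg_view_of:
  assumes "weighted_graph G w" and "boundary G (set t) \<noteq> {}"
  shows "greedy_alg (view_of G w f t) \<in> boundary G (set t)"
    and "u \<in> boundary G (set t) \<Longrightarrow>
      gdist (known_subgraph G (set t)) w (last t) (greedy_alg (view_of G w f t))
          + ereal (f (greedy_alg (view_of G w f t)))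
        \<le> gdist (known_subgraph G (set t)) w (last t) u + ereal (f u)"
proof -
  let ?K = "known_subgraph G (set t)"
  let ?h = "\<lambda>v. gdist ?K (restrict w (parcs ?K)) (last t) v + ereal (restrict f (pverts ?K) v)"
  \<comment> \<open>Known arcs and boundary vertices lie in the domains of restriction, so the value
    computed from the view is the true one.\<close>
  have h: "?h v = gdist ?K w (last t) v + ereal (f v)" if "v \<in> boundary G (set t)" for v
    using that gdist_cong[OF wf_digraph_known_subgraph, of G "set t" "restrict w (parcs ?K)" w]
    by (simp add: known_subgraph_def)
  have "pverts ?K - set t = boundary G (set t)"
    by (auto simp: known_subgraph_def boundary_def)
  then have alg: "greedy_alg (view_of G w f t) = arg_min_on ?h (boundary G (set t))"
    by (simp add: greedy_alg_def view_of_def)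
  note min = arg_min_if_finite[OF finite_boundary[OF assms(1)] assms(2), of ?h, folded alg]
  show mem: "greedy_alg (view_of G w f t) \<in> boundary G (set t)"
    by (rule min(1))
  show "gdist ?K w (last t) (greedy_alg (view_of G w f t)) + ereal (f (greedy_alg (view_of G w f t)))
        \<le> gdist ?K w (last t) u + ereal (f u)" if "u \<in> boundary G (set t)"
    using min(2) that h[OF mem] h[OF that] by (metis not_le)
qed

lemma is_search_alg_greedy_alg: "is_search_alg greedy_alg"
  unfolding is_search_alg_def using greedy_alg_view_of(1) by blast

text \<open>The walk is cut at its first vertex outside \<open>S\<close>. Every arc before the cut
  has its tail in \<open>S\<close> and is therefore known.\<close>

lemma awalk_leaves_set:
  assumes "wf_digraph (with_proj G)"
    and "pre_digraph.awalk (with_proj G) x p g" and "x \<in> S" and "g \<notin> S"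
  shows "\<exists>u q s. u \<in> boundary G S \<and> p = q @ s \<and>
      pre_digraph.awalk (with_proj (known_subgraph G S)) x q u \<and>
      pre_digraph.awalk (with_proj G) u s g"
  using assms(2,3)
proof (induction p arbitrary: x)
  interpret wf_digraph "with_proj G" by fact
  case Nil
  then show ?case using assms(4) by (simp add: awalk_Nil_iff)
next
  interpret wf_digraph "with_proj G" by fact
  interpret K: wf_digraph "with_proj (known_subgraph G S)"
    by (rule wf_digraph_known_subgraph)
  case (Cons e p)
  obtain y where e: "e = (x, y)" "(x, y) \<in> parcs G" and p: "awalk y p g"
    using Cons.prems(1) by (cases e) (auto simp: awalk_Cons_iff)
  have y: "y \<in> pverts G"
    using p by (auto simp: awalk_def)
  show ?case
  proof (cases "y \<in> S")
    case True
    with Cons.IH[OF p] obtain u q s where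
      "u \<in> boundary G S" "p = q @ s" "K.awalk y q u" "awalk u s g"
      by blast
    moreover have "e \<in> parcs (known_subgraph G S)"
      using e True Cons.prems(2) by (simp add: known_subgraph_def)
    ultimately show ?thesis
      using e(1) by (intro exI[of _ u] exI[of _ "e # q"] exI[of _ s]) (simp add: K.awalk_Cons_iff)
  next
    case False
    then have "y \<in> boundary G S"
      using e y Cons.prems(2) by (auto simp: boundary_def)
    moreover from this have "K.awalk x [e] y"
      using e Cons.prems(2) K.arc_implies_awalk[of e] by (simp add: known_subgraph_def)
    ultimately show ?thesis
      using p by (intro exI[of _ y] exI[of _ "[e]"] exI[of _ p]) simp
  qed
qed

lemma reachable_imp_boundary_nonempty:
  assumes "wf_digraph (with_proj G)" "reachable (with_proj G) x g" "x \<in> S" "g \<notin> S"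
  shows "boundary G S \<noteq> {}"
proof -
  interpret wf_digraph "with_proj G" by fact
  show ?thesis
    using assms(2) awalk_leaves_set[OF assms(1) _ assms(3,4)] by (auto simp: reachable_awalk)
qed

text \<open>An infinite distance does no harm here: the difference is then -\<infinity> and is cut
  off at 0. So the maximum, attained on a finite set containing \<open>g\<close>, is a real
  number.\<close>

lemma
  assumes "weighted_graph G w" "g \<in> pverts G"
  shows err_inf_plus_finite: "\<exists>E \<ge> 0. err_inf_plus G w f g = ereal E"
    and err_inf_plus_ge: "v \<in> pverts G \<Longrightarrow> ereal (f v) - gdist G w v g \<le> err_inf_plus G w f g"
proof -
  let ?e = "\<lambda>v. max 0 (ereal (f v) - gdist G w v g)"
  have fin: "finite (pverts G)"
    using assms(1) by (auto simp: weighted_graph_def dest: pair_fin_digraph.pair_finite_verts)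
  have "Max (?e ` pverts G) \<in> ?e ` pverts G"
    using fin assms(2) by (intro Max_in) auto
  then obtain v where v: "err_inf_plus G w f g = ?e v"
    by (auto simp: err_inf_plus_def)
  show "\<exists>E \<ge> 0. err_inf_plus G w f g = ereal E"
  proof (cases "gdist G w v g")
    case (real a)
    then show ?thesis
      using v by (intro exI[of _ "max 0 (f v - a)"]) (simp add: max_def zero_ereal_def)
  qed (use v gdist_nonneg[OF assms(1), of v g] in \<open>auto simp: zero_ereal_def\<close>)
  show "ereal (f v) - gdist G w v g \<le> err_inf_plus G w f g" if "v \<in> pverts G" for v
  proof -
    have "?e v \<le> err_inf_plus G w f g"
      unfolding err_inf_plus_def using fin that by (intro Max_ge) auto
    then show ?thesis by simp
  qed
qed

text \<open>The prediction at the chosen vertex stays on the left; it is traded later for the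
  distance and the underestimate at that vertex.\<close>

lemma greedy_alg_hop:
  assumes G: "weighted_graph G w" and t: "t \<noteq> []" and g: "g \<in> pverts G" "g \<notin> set t"
    and D: "gdist G w (last t) g = ereal D" and E: "err_inf_plus G w f g = ereal E"
  shows "gdist (known_subgraph G (set t)) w (last t) (greedy_alg (view_of G w f t))
           + ereal (f (greedy_alg (view_of G w f t))) \<le> ereal (D + E)"
proof -
  interpret fin_digraph "with_proj G"
    using G by (rule weighted_graph_imp_fin_digraph)
  interpret K: wf_digraph "with_proj (known_subgraph G (set t))"
    by (rule wf_digraph_known_subgraph)
  have "reachable (with_proj G) (last t) g"
    using shortest_path_inf[of "last t" g w] D by auto
  \<comment> \<open>As weights are nonnegative and \<open>g\<close> is reachable, the infimum
    defining the distance is attained by a path.\<close>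
  then obtain p where "apath (last t) p g" and cost: "gdist G w (last t) g = awalk_cost w p"
    using min_cost_awalk[of "last t" g w] G by (auto simp: weighted_graph_def less_imp_le)
  then have p: "awalk (last t) p g"
    by (simp add: awalkI_apath)
  then obtain u q s where u: "u \<in> boundary G (set t)" and qs: "p = q @ s"
    and q: "K.awalk (last t) q u" and s: "awalk u s g"
    using awalk_leaves_set[OF wf_digraph_axioms p _ g(2)] t by auto
  have "ereal (f u) - gdist G w u g \<le> ereal E"
    using err_inf_plus_ge[OF G g(1), of u f] u E by (simp add: boundary_def)
  \<comment> \<open>The distance from \<open>u\<close> is replaced by the cost of \<open>s\<close>,
    because the costs of \<open>q\<close> and \<open>s\<close> add up to \<open>D\<close>.\<close>
  moreover have "gdist G w u g \<le> ereal (awalk_cost w s)"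
    using s by (rule min_cost_le_walk_cost)
  ultimately have "f u \<le> awalk_cost w s + E"
    using gdist_nonneg[OF G, of u g] by (cases "gdist G w u g") auto
  moreover have "D = awalk_cost w q + awalk_cost w s"
    using D cost qs by simp
  ultimately have "awalk_cost w q + f u \<le> D + E"
    by simp
  \<comment> \<open>The cost of a walk depends only on its arcs and \<open>w\<close>, so
    \<open>q\<close> costs the same in the known subgraph as in \<open>G\<close>.\<close>
  moreover have "gdist (known_subgraph G (set t)) w (last t) u + ereal (f u)
      \<le> ereal (awalk_cost w q) + ereal (f u)"
    using K.min_cost_le_walk_cost[OF q, of w]
    by (intro add_right_mono) (simp add: K.awalk_cost_def awalk_cost_def)
  moreover have "boundary G (set t) \<noteq> {}"
    using u by blast
  note greedy_alg_view_of(2)[OF G this u, of f]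
  ultimately show ?thesis
    by (metis (no_types, lifting) ereal_less_eq(3) order_trans plus_ereal.simps(1))
qed

section \<open>Positions of the agent\<close>

lemma trail_ne: "trail alg G w f r i \<noteq> []"
  by (cases i) auto

lemma set_trail: "set (trail alg G w f r i) = agent_pos alg G w f r ` {..i}"
  by (induction i) (auto simp: agent_pos_def atMost_Suc)

text \<open>The root is visited and \<open>g\<close> is not, so the reachability of \<open>g\<close>
  leaves a boundary vertex to choose.\<close>

lemma greedy_alg_agent_pos_in_boundary:
  assumes "weighted_graph G w" "r \<in> pverts G" "reachable (with_proj G) r g"
    and "\<forall>j\<le>i. agent_pos greedy_alg G w f r j \<noteq> g"
  shows "agent_pos greedy_alg G w f r (Suc i)
      \<in> boundary G (agent_pos greedy_alg G w f r ` {..i})"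
proof -
  let ?S = "agent_pos greedy_alg G w f r ` {..i}"
  have "r = agent_pos greedy_alg G w f r 0"
    by (simp add: agent_pos_def)
  then have "r \<in> ?S"
    by blast
  then have "boundary G ?S \<noteq> {}"
    using assms(3,4) by (intro reachable_imp_boundary_nonempty[of G r g]
      weighted_graph_imp_wf_digraph[OF assms(1)]) auto
  then show ?thesis
    using greedy_alg_view_of(1)[OF assms(1), of "trail greedy_alg G w f r i"]
    unfolding set_trail by (simp add: agent_pos_def)
qed

text \<open>Boundary vertices are unvisited. Distinctness bounds the number of hops and lets each
  vertex be charged for its underestimate at most once.\<close>

lemma inj_on_agent_pos:
  assumes "\<And>i. i < k \<Longrightarrow> agent_pos alg G w f r (Suc i) \<in> boundary G (agent_pos alg G w f r ` {..i})"
  shows "inj_on (agent_pos alg G w f r) {..k}"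
proof (rule linorder_inj_onI')
  fix i j assume "i \<in> {..k}" "j \<in> {..k}" "i < j"
  then obtain j' where j': "j = Suc j'" "j' < k" "i \<le> j'"
    by (cases j) auto
  then have "agent_pos alg G w f r j \<notin> agent_pos alg G w f r ` {..j'}"
    using assms[of j'] by (simp add: boundary_def)
  then show "agent_pos alg G w f r i \<noteq> agent_pos alg G w f r j"
    using j'(3) by (metis atMost_iff imageI)
qed

lemma agent_pos_in_pverts:
  assumes "\<And>i. i < k \<Longrightarrow> agent_pos alg G w f r (Suc i) \<in> boundary G (agent_pos alg G w f r ` {..i})"
    and "r \<in> pverts G" "i \<le> k"
  shows "agent_pos alg G w f r i \<in> pverts G"
  using assms(1)[of "i - 1"] assms(2,3) by (cases i) (auto simp: agent_pos_def boundary_def)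

section \<open>Termination and total cost\<close>

lemma finds_goal_greedy_alg:
  assumes "weighted_graph G w" "r \<in> pverts G" "reachable (with_proj G) r g"
  shows "finds_goal greedy_alg G w f r g"
proof (rule ccontr)
  let ?x = "agent_pos greedy_alg G w f r"
  assume "\<not> ?thesis"
  then have step: "?x (Suc i) \<in> boundary G (?x ` {..i})" for i
    using greedy_alg_agent_pos_in_boundary[OF assms] by (auto simp: finds_goal_def)
  have fin: "finite (pverts G)"
    using assms(1) by (auto simp: weighted_graph_def dest: pair_fin_digraph.pair_finite_verts)
  let ?n = "card (pverts G)"
  \<comment> \<open>A search that never meets \<open>g\<close> would have \<open>?n + 1\<close>
    distinct positions among \<open>?n\<close> vertices.\<close>
  have "card {..?n} \<le> card (pverts G)"
    using step by (intro card_inj_on_le[OF inj_on_agent_pos _ fin])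
      (auto intro: agent_pos_in_pverts[OF _ assms(2)])
  then show False by simp
qed

lemma search_cost_greedy_alg:
  assumes G: "weighted_graph G w" and r: "r \<in> pverts G" and g: "g \<in> pverts G"
    and reach: "reachable (with_proj G) r g"
  shows "search_cost greedy_alg G w f r g
     \<le> gdist G w r g + err_1_minus G w f g + ereal (real (card (pverts G))) * err_inf_plus G w f g"
proof (cases "\<exists>v\<in>pverts G. gdist G w v g = \<infinity>")
  case True
  have "finite (pverts G)"
    using G by (auto simp: weighted_graph_def dest: pair_fin_digraph.pair_finite_verts)
  then have "err_1_minus G w f g = \<infinity>"
    using True unfolding err_1_minus_def by (subst sum_Pinfty) force
  moreover have "gdist G w r g \<noteq> -\<infinity>"
    using gdist_nonneg[OF G, of r g] by auto
  ultimately show ?thesis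
    using err_inf_plus_finite[OF G g, of f] by auto
next
  case False
  \<comment> \<open>All distances to \<open>g\<close> are now finite, so the estimates move to the
    reals, where differences telescope.\<close>
  define D where "D v = real_of_ereal (gdist G w v g)" for v
  have D: "gdist G w v g = ereal (D v)" if "v \<in> pverts G" for v
    using False that gdist_nonneg[OF G, of v g] unfolding D_def
    by (cases "gdist G w v g") auto
  obtain E where E: "E \<ge> 0" "err_inf_plus G w f g = ereal E"
    using err_inf_plus_finite[OF G g] by blast
  let ?x = "agent_pos greedy_alg G w f r"
  let ?n = "card (pverts G)"
  define k where "k = (LEAST k. ?x k = g)"
  define e where "e v = max 0 (D v - f v)" for v
  define c where "c i = gdist (known_subgraph G (set (trail greedy_alg G w f r i))) w
    (?x i) (?x (Suc i))" for i
  have fin: "finite (pverts G)"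
    using G by (auto simp: weighted_graph_def dest: pair_fin_digraph.pair_finite_verts)
  have k: "?x k = g"
    using finds_goal_greedy_alg[OF G r reach, of f] unfolding finds_goal_def k_def by (rule LeastI_ex)
  have not_g: "?x i \<noteq> g" if "i < k" for i
    using that not_less_Least unfolding k_def by blast
  have step: "?x (Suc i) \<in> boundary G (?x ` {..i})" if "i < k" for i
    using that not_g by (intro greedy_alg_agent_pos_in_boundary[OF G r reach]) auto
  have inj: "inj_on ?x {..k}"
    using step by (rule inj_on_agent_pos)
  note mem = agent_pos_in_pverts[OF step r]
  \<comment> \<open>At the new vertex \<open>v\<close>, \<open>f v\<close> is at least
    \<open>D v - e v\<close>, which replaces the prediction in the bound of
    \<open>greedy_alg_hop\<close>.\<close>
  have hop: "c i \<le> ereal (D (?x i) - D (?x (Suc i)) + e (?x (Suc i)) + E)" if i: "i < k" for i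
  proof -
    have "g \<notin> set (trail greedy_alg G w f r i)"
      using i not_g unfolding set_trail by (metis atMost_iff imageE le_less_trans)
    from greedy_alg_hop[OF G trail_ne g this _ E(2), of "D (?x i)"]
    have "c i + ereal (f (?x (Suc i))) \<le> ereal (D (?x i) + E)"
      using D[OF mem[of i]] i by (simp add: c_def agent_pos_def)
    then show ?thesis
      unfolding e_def by (cases "c i") auto
  qed
  \<comment> \<open>Underestimates are charged at the ends of hops, hence the shift by
    \<open>Suc\<close>.\<close>
  have "inj_on (?x \<circ> Suc) {..<k}"
    by (intro comp_inj_on inj_on_subset[OF inj]) auto
  then have "(\<Sum>i<k. e (?x (Suc i))) = sum e ((?x \<circ> Suc) ` {..<k})"
    by (subst sum.reindex) simp_all
  also have "\<dots> \<le> sum e (pverts G)"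
    using fin mem by (intro sum_mono2) (auto simp: e_def)
  finally have sum_e: "(\<Sum>i<k. e (?x (Suc i))) \<le> sum e (pverts G)" .
  \<comment> \<open>There are \<open>k + 1\<close> distinct positions, so the \<open>k\<close> hops
    number fewer than \<open>?n\<close>.\<close>
  have "card {..k} \<le> ?n"
    using mem by (intro card_inj_on_le[OF inj _ fin]) auto
  then have kE: "real k * E \<le> real ?n * E"
    using E(1) by (intro mult_right_mono) auto
  \<comment> \<open>The last position is the goal, at distance 0 from itself, so telescoping leaves
    only the distance from the root, which is OPT.\<close>
  have "D g = 0"
    using gdist_self[OF G g] D[OF g] by simp
  moreover have "?x 0 = r"
    by (simp add: agent_pos_def)
  ultimately have tele: "(\<Sum>i<k. D (?x i) - D (?x (Suc i))) = D r"
    using k sum_lessThan_telescope'[of "\<lambda>i. D (?x i)" k] by simp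
  have "search_cost greedy_alg G w f r g = (\<Sum>i<k. c i)"
    by (simp add: search_cost_def k_def c_def)
  also have "\<dots> \<le> (\<Sum>i<k. ereal (D (?x i) - D (?x (Suc i)) + e (?x (Suc i)) + E))"
    using hop by (intro sum_mono) auto
  also have "\<dots> = ereal (D r + (\<Sum>i<k. e (?x (Suc i))) + real k * E)"
    by (simp add: sum.distrib tele)
  also have "\<dots> \<le> ereal (D r + sum e (pverts G) + real ?n * E)"
    using sum_e kE by simp
  also have "\<dots> = gdist G w r g + ereal (sum e (pverts G)) + ereal (real ?n) * err_inf_plus G w f g"
    using D[OF r] E(2) by simp
  also have "ereal (sum e (pverts G)) = err_1_minus G w f g"
    unfolding err_1_minus_def sum_ereal[symmetric]
    by (intro sum.cong) (auto simp: D e_def max_def zero_ereal_def)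
  finally show ?thesis .
qed

theorem theorem1:
  shows "\<exists>alg :: 'a search_alg. is_search_alg alg \<and>
    (\<forall>(G :: 'a pair_pre_digraph) (w :: 'a \<times> 'a \<Rightarrow> real) (f :: 'a \<Rightarrow> real) (r :: 'a) (g :: 'a).
       weighted_graph G w \<and> r \<in> pverts G \<and> g \<in> pverts G \<and> reachable (with_proj G) r g \<longrightarrow>
         finds_goal alg G w f r g \<and>
         search_cost alg G w f r g
           \<le> gdist G w r g + err_1_minus G w f g
             + ereal (real (card (pverts G))) * err_inf_plus G w f g)"
  by (intro exI[of _ greedy_alg] conjI allI impI is_search_alg_greedy_alg)
    (auto intro: finds_goal_greedy_alg search_cost_greedy_alg)

end
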